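(* Let $X$ and $Y$ be locally compact Hausdorff spaces, let $E$ and $F$ be real or complex normed spaces (not necessarily complete), let $A$ be a completely regular subspace of $C_0(X,E)$ and let $B$ be an $F$-separating subspace of $C_0(Y,F)$, both equipped with the supremum norm. Let $T: A\to B$ be a surjective real-linear isometry. If $F$ satisfies property $(D_w)$, then there exist a continuous map $\varphi: Y\to X$ and a family $\{V_y\}_{y\in Y}$ of bounded real-linear operators from $E$ to $F$ with $\|V_y\|\le 1$ such that for each $y\in Y$ \[ Tf(y)=V_y(f(\varphi(y)))\qquad (f\in A).\] Moreover, if $E$ also satisfies property $(D_w)$ and $B$ is completely regular, then $\varphi$ is a homeomorphism and each $V_y$ is a surjective isometry.
   Context: For a locally compact Hausdorff space $X$ and a real or complex normed space $E$, $C_0(X,E)$ is the normed space of all continuous $E$-valued functions on $X$ vanishing at infinity, with the supremum norm $\|\cdot\|_\infty$. A subset $S$ of a normed space $E$ is norm additive if $\|e_1+\cdots+e_n\|=\|e_1\|+\cdots+\|e_n\|$ for every finite collection $e_1,\dots,e_n$ of elements of $S$. A $T$-set in $E$ is a maximal (with respect to inclusion) norm additive subset of $E$. Property $(D_w)$: a normed space $E$ satisfies property $(D_w)$ if there exists a $T$-set $R_0$ in $E$ such that for every $T$-set $R$ in $E$ distinct from $R_0$, either $R_0\cap R=\{0\}$ or there exists a $T$-set $L$ in $E$ with $R_0\cap L=R\cap L=\{0\}$. A subspace $A$ of $C_0(X,E)$ is $E$-separating if for any distinct points $x_1\neq x_2$ in $X$ and any $u\in E$ there exists $f\in A$ with $f(x_1)=u$,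 $\|f\|_\infty=\|u\|$ and $f(x_2)=0$. (The notion of an $F$-separating subspace of $C_0(Y,F)$ is the same with $Y,F$ in place of $X,E$.) A subspace $A$ of $C_0(X,E)$ is completely regular if for any $x\in X$, any $u\in E$ and any neighbourhood $U$ of $x$ there exists $f\in A$ with $f(x)=u$, $\|f\|_\infty=\|u\|$ and $f=0$ on $X\setminus U$.
   Formalization: X and Y are assumed nonempty; if Y is a single point, B is assumed to be all of C_0(Y,F), since F-separation is then vacuous and the claim can fail; the "moreover" part assumes E is not {0}, since otherwise X and Y need not be homeomorphic. *)

theory Defs
  imports "HOL-Analysis.Analysis"
begin

text \<open>
  Scalars: every notion below depends only on the norm and the additive structure, and the operator
  in the theorem is real-linear. A complex normed space and a complex subspace are therefore covered
  by their underlying real normed space and real subspace.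
\<close>

text \<open>
  A continuous function vanishing at infinity is bounded, so \<open>C\<^sub>0(X,E)\<close> is a subset of the type
  of bounded continuous functions, whose norm is the supremum norm.
\<close>

definition C0 :: "('x::topological_space \<Rightarrow>\<^sub>C 'e::real_normed_vector) set"
  where "C0 = {f. \<forall>\<epsilon>>0. compact {x. \<epsilon> \<le> norm (apply_bcontfun f x)}}"

text \<open>Finite collections may repeat elements, hence lists.\<close>

definition norm_additive :: "'e::real_normed_vector set \<Rightarrow> bool"
  where "norm_additive S \<longleftrightarrow>
    (\<forall>es. set es \<subseteq> S \<longrightarrow> norm (sum_list es) = sum_list (map norm es))"

definition T_set :: "'e::real_normed_vector set \<Rightarrow> bool"
  where "T_set S \<longleftrightarrow> norm_additive S \<and> (\<forall>S'. norm_additive S' \<and> S \<subseteq> S' \<longrightarrow> S' = S)"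

definition property_Dw :: "'e::real_normed_vector itself \<Rightarrow> bool"
  where "property_Dw (_ :: 'e itself) \<longleftrightarrow>
    (\<exists>R\<^sub>0 :: 'e set. T_set R\<^sub>0 \<and>
      (\<forall>R. T_set R \<and> R \<noteq> R\<^sub>0 \<longrightarrow>
        R\<^sub>0 \<inter> R = {0} \<or> (\<exists>L. T_set L \<and> R\<^sub>0 \<inter> L = {0} \<and> R \<inter> L = {0})))"

definition separating_subspace ::
    "('x::topological_space \<Rightarrow>\<^sub>C 'e::real_normed_vector) set \<Rightarrow> bool"
  where "separating_subspace A \<longleftrightarrow> subspace A \<and> A \<subseteq> C0 \<and>
    (\<forall>x1 x2 u. x1 \<noteq> x2 \<longrightarrow>
      (\<exists>f\<in>A. apply_bcontfun f x1 = u \<and> norm f = norm u \<and> apply_bcontfun f x2 = 0))"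

definition completely_regular_subspace ::
    "('x::topological_space \<Rightarrow>\<^sub>C 'e::real_normed_vector) set \<Rightarrow> bool"
  where "completely_regular_subspace A \<longleftrightarrow> subspace A \<and> A \<subseteq> C0 \<and>
    (\<forall>x u U. x \<in> interior U \<longrightarrow>
      (\<exists>f\<in>A. apply_bcontfun f x = u \<and> norm f = norm u \<and> (\<forall>z. z \<notin> U \<longrightarrow> apply_bcontfun f z = 0)))"

text \<open>
  In the theorem the domain of the operator is a subspace \<open>A\<close> of a function space; in HOL it is a
  total function of which only the values on \<open>A\<close> matter.
\<close>

definition real_linear_on :: "'v::real_vector set \<Rightarrow> ('v \<Rightarrow> 'w::real_vector) \<Rightarrow> bool"
  where "real_linear_on A T \<longleftrightarrow>
    (\<forall>f\<in>A. \<forall>g\<in>A. T (f + g) = T f + T g) \<and> (\<forall>c. \<forall>f\<in>A. T (c *\<^sub>R f) = c *\<^sub>R T f)"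

definition isometry_on :: "'v::metric_space set \<Rightarrow> ('v \<Rightarrow> 'w::metric_space) \<Rightarrow> bool"
  where "isometry_on A T \<longleftrightarrow> (\<forall>f\<in>A. \<forall>g\<in>A. dist (T f) (T g) = dist f g)"

text \<open>
  Degenerate cases. Type-class spaces are nonempty.

  \<open>separating_subspace B\<close> has no content (beyond being a subspace) if \<open>Y\<close> is a single point, and
  the representation of the isometry then fails in general: let \<open>X\<close> be a discrete two-point space,
  \<open>E = \<real>\<close>, \<open>A = C\<^sub>0(X,E)\<close>, which is the plane with the maximum norm, and let \<open>F\<close> be the
  Euclidean direct sum of that plane and \<open>\<real>\<close>. The ray spanned by \<open>(0,0,1)\<close> is a T-set of \<open>F\<close>, so
  \<open>F\<close> has \<open>(D\<^sub>w)\<close>, but the inclusion of \<open>A\<close> into \<open>F = C\<^sub>0(Y,F)\<close> does not factor through a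
  point evaluation. For a one-point \<open>Y\<close> the theorem therefore takes \<open>B\<close> to be all of
  \<open>C\<^sub>0(Y,F)\<close>, i.e. every value in \<open>F\<close> is attained, as the separation condition gives when
  there are at least two points.

  If \<open>E = F = {0}\<close>, all function spaces are \<open>{0}\<close> and nothing relates \<open>X\<close> to \<open>Y\<close>, so the
  homeomorphism claim needs \<open>E \<noteq> {0}\<close>.
\<close>

end

theory Submission
  imports Defs
begin

text \<open>
  A norm additive set of functions vanishing at infinity has a common peak point. Finite sums of
  its members attain their norms, which forces all summands to peak at the same place and to have
  norm additive values there, and compactness extends this from finitely many members to all. Hence
  the T-sets of \<open>B\<close> are the sets of functions that peak at a point \<open>y\<close> with value in a T-set
  \<open>R\<close> of \<open>F\<close> (lemmas \<open>norm_additive_subset_peak_set\<close> and \<open>peak_set_maximal\<close>). Being norm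
  additive is preserved by a linear isometry, so \<open>T\<close> matches the peak set of \<open>(y, R)\<close> with the
  peak set of some \<open>(x, Q)\<close> in \<open>A\<close> (lemma \<open>carried_exists\<close>).

  The point \<open>x\<close> might depend on \<open>R\<close>. If \<open>R \<inter> R' = {0}\<close> and the points \<open>x\<close>, \<open>x'\<close> of
  \<open>(y, R)\<close> and \<open>(y, R')\<close> were different, then two bumps with disjoint supports would add up to a
  nonzero function peaking at both points, and the value at \<open>y\<close> of its image would be a nonzero
  element of \<open>R \<inter> R'\<close>. Property \<open>(D\<^sub>w)\<close> says that every T-set is linked to the fixed one by at most
  two such steps, so \<open>x = \<phi>(y)\<close> depends on \<open>y\<close> only (lemma \<open>common_carrier_point\<close>).

  If \<open>f(\<phi>(y)) = 0\<close>, then \<open>Tf(y) = 0\<close>. To see this, put \<open>Tf(y)\<close> into a T-set \<open>R\<close> and add to \<open>f\<close> a tall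
  bump \<open>g\<close> from the matching peak set, supported where \<open>f\<close> is small: the norm of \<open>f + g\<close> barely
  exceeds that of \<open>g\<close>, whereas \<open>Tf(y)\<close> and \<open>Tg(y)\<close> lie in \<open>R\<close> and their norms add up (lemma
  \<open>image_vanishes\<close>). Thus \<open>Tf(y)\<close> is a function of \<open>f(\<phi>(y))\<close>, which is the operator \<open>V\<^sub>y\<close>. The
  statement about homeomorphisms follows by applying all this to the inverse of \<open>T\<close> as well.
\<close>

section \<open>Norm additive sets and T-sets\<close>

lemma norm_sum_list_le: "norm (sum_list es) \<le> sum_list (map norm es)"
  for es :: "'e::real_normed_vector list"
  by (induction es) (auto intro: norm_triangle_le)

lemma norm_additiveI:
  assumes "\<And>es. set es \<subseteq> S \<Longrightarrow> sum_list (map norm es) \<le> norm (sum_list es)"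
  shows "norm_additive S"
  unfolding norm_additive_def using assms norm_sum_list_le by (metis order_antisym)

lemma norm_additiveD:
  "norm_additive S \<Longrightarrow> set es \<subseteq> S \<Longrightarrow> norm (sum_list es) = sum_list (map norm es)"
  by (simp add: norm_additive_def)

lemma norm_additive_pair:
  "norm_additive S \<Longrightarrow> a \<in> S \<Longrightarrow> b \<in> S \<Longrightarrow> norm (a + b) = norm a + norm b"
  using norm_additiveD[of S "[a, b]"] by simp

lemma list_in_image:
  assumes "set gs \<subseteq> h ` S"
  shows "\<exists>fs. gs = map h fs \<and> set fs \<subseteq> S"
proof -
  have "gs \<in> map h ` lists S"
    using assms by (metis in_lists_conv_set lists_image subsetD)
  then show ?thesis by (auto simp: in_lists_conv_set)
qed

lemma norm_additive_singleton: "norm_additive {e}"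
  unfolding norm_additive_def
proof (intro allI impI)
  fix es assume "set es \<subseteq> {e}"
  then have "es = replicate (length es) e"
    by (intro replicate_eqI) auto
  then obtain n where es: "es = replicate n e" by blast
  have "sum_list (replicate n e) = real n *\<^sub>R e"
    by (induction n) (auto simp: scaleR_left_distrib)
  moreover have "sum_list (replicate n (norm e)) = real n * norm e"
    by (induction n) (auto simp: distrib_right)
  ultimately show "norm (sum_list es) = sum_list (map norm es)"
    by (simp add: es)
qed

text \<open>A sum of sums is the sum of the concatenated lists.\<close>

lemma norm_additive_sums:
  assumes "norm_additive S"
  shows "norm_additive {sum_list es |es. set es \<subseteq> S}"
  unfolding norm_additive_def
proof (intro allI impI)
  fix gs assume "set gs \<subseteq> {sum_list es |es. set es \<subseteq> S}"
  then have "set gs \<subseteq> sum_list ` {es. set es \<subseteq> S}" by blast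
  from list_in_image[OF this] obtain ess where gs: "gs = map sum_list ess" and ess: "\<forall>es\<in>set ess. set es \<subseteq> S"
    by blast
  have sum: "sum_list gs = sum_list (concat ess)"
    unfolding gs by (induction ess) auto
  have "norm (sum_list (concat ess)) = sum_list (map norm (concat ess))"
    using assms ess by (intro norm_additiveD) auto
  also have "\<dots> = sum_list (map norm gs)"
    unfolding gs using ess norm_additiveD[OF assms] by (induction ess) auto
  finally show "norm (sum_list gs) = sum_list (map norm gs)"
    by (simp add: sum)
qed

text \<open>
  T-sets are cones because the norms stay additive under nonnegative coefficients \<open>c\<close>: replacing
  each \<open>c\<close> by a common upper bound \<open>C\<close> changes the sum by a vector whose norm the triangle
  inequality bounds by exactly what the sum of the norms gains.
\<close>

lemma norm_additive_cone:
  assumes "norm_additive S"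
  shows "norm_additive {c *\<^sub>R e |c e. 0 \<le> c \<and> e \<in> S}"
proof (rule norm_additiveI)
  fix es assume "set es \<subseteq> {c *\<^sub>R e |c e. 0 \<le> c \<and> e \<in> S}"
  then have "set es \<subseteq> (\<lambda>p. fst p *\<^sub>R snd p) ` {p. 0 \<le> fst p \<and> snd p \<in> S}"
    by (rule order_trans) (force simp: image_iff)
  from list_in_image[OF this] obtain ps where es: "es = map (\<lambda>p. fst p *\<^sub>R snd p) ps"
    and ps: "\<forall>p\<in>set ps. 0 \<le> fst p \<and> snd p \<in> S" by blast
  define C where "C = sum_list (map fst ps)"
  have C: "fst p \<le> C" if "p \<in> set ps" for p
    unfolding C_def using that ps by (intro member_le_sum_list) auto
  have "0 \<le> C"
    unfolding C_def using ps by (intro sum_list_nonneg) auto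
  let ?N = "sum_list (map (\<lambda>p. norm (snd p)) ps)"
  have diff: "norm (C *\<^sub>R sum_list (map snd ps) - sum_list es) \<le> C * ?N - sum_list (map norm es)"
    unfolding es using C ps
  proof (induction ps)
    case (Cons p ps)
    let ?d = "C *\<^sub>R sum_list (map snd ps) - sum_list (map (\<lambda>p. fst p *\<^sub>R snd p) ps)"
    have "C *\<^sub>R sum_list (map snd (p # ps)) - sum_list (map (\<lambda>p. fst p *\<^sub>R snd p) (p # ps))
        = (C - fst p) *\<^sub>R snd p + ?d"
      by (simp add: algebra_simps)
    moreover have "norm ((C - fst p) *\<^sub>R snd p + ?d) \<le> (C - fst p) * norm (snd p) + norm ?d"
      by (rule norm_triangle_le) (use Cons.prems in simp)
    moreover have "norm ?d \<le> C * sum_list (map (\<lambda>p. norm (snd p)) ps)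
        - sum_list (map norm (map (\<lambda>p. fst p *\<^sub>R snd p) ps))"
      using Cons by simp
    ultimately show ?case
      using Cons.prems by (simp add: algebra_simps)
  qed simp
  have "norm (sum_list (map snd ps)) = ?N"
    using norm_additiveD[OF assms, of "map snd ps"] ps by (auto simp: comp_def)
  then have "C * ?N = norm (C *\<^sub>R sum_list (map snd ps))"
    using \<open>0 \<le> C\<close> by simp
  also have "\<dots> \<le> norm (sum_list es) + norm (C *\<^sub>R sum_list (map snd ps) - sum_list es)"
    by (metis norm_triangle_sub)
  finally show "sum_list (map norm es) \<le> norm (sum_list es)"
    using diff by linarith
qed

lemma norm_additive_extends_to_T_set:
  assumes "norm_additive S"
  shows "\<exists>R. T_set R \<and> S \<subseteq> R"
proof -
  have "\<exists>M\<in>{R. norm_additive R \<and> S \<subseteq> R}.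
      \<forall>X\<in>{R. norm_additive R \<and> S \<subseteq> R}. M \<subseteq> X \<longrightarrow> X = M"
  proof (rule subset_Zorn_nonempty)
    show "{R. norm_additive R \<and> S \<subseteq> R} \<noteq> {}"
      using assms by blast
    fix \<C> assume ne: "\<C> \<noteq> {}" and chain: "subset.chain {R. norm_additive R \<and> S \<subseteq> R} \<C>"
    then have mem: "norm_additive R" "S \<subseteq> R" if "R \<in> \<C>" for R
      using that by (auto simp: subset.chain_def)
    have "norm_additive (\<Union>\<C>)"
      unfolding norm_additive_def
    proof (intro allI impI)
      fix es assume "set es \<subseteq> \<Union>\<C>"
      then obtain R where "R \<in> \<C>" "set es \<subseteq> R"
        using finite_subset_Union_chain[OF _ _ ne chain, of "set es"] by auto
      then show "norm (sum_list es) = sum_list (map norm es)"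
        using mem norm_additiveD by blast
    qed
    then show "\<Union>\<C> \<in> {R. norm_additive R \<and> S \<subseteq> R}"
      using ne mem by blast
  qed
  then obtain M where "norm_additive M" "S \<subseteq> M"
    and "\<forall>X. norm_additive X \<and> S \<subseteq> X \<longrightarrow> M \<subseteq> X \<longrightarrow> X = M" by auto
  then show ?thesis
    unfolding T_set_def by (intro exI[of _ M]) auto
qed

lemma T_set_norm_additive: "T_set R \<Longrightarrow> norm_additive R"
  by (simp add: T_set_def)

lemma T_set_maximal: "T_set R \<Longrightarrow> norm_additive S \<Longrightarrow> R \<subseteq> S \<Longrightarrow> S = R"
  by (simp add: T_set_def)

lemma T_set_scaleR:
  assumes "T_set R" "e \<in> R" "0 \<le> c"
  shows "c *\<^sub>R e \<in> R"
proof -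
  have "R \<subseteq> {c *\<^sub>R e |c e. 0 \<le> c \<and> e \<in> R}"
    by (auto intro: exI[of _ 1])
  then have "{c *\<^sub>R e |c e. 0 \<le> c \<and> e \<in> R} = R"
    using assms(1) by (intro T_set_maximal norm_additive_cone T_set_norm_additive)
  then show ?thesis using assms(2,3) by blast
qed

lemma T_set_element_of_norm:
  fixes R :: "'e::real_normed_vector set"
  assumes "\<exists>u::'e. u \<noteq> 0" "T_set R" "0 \<le> r"
  shows "\<exists>q\<in>R. norm q = r"
proof -
  have "\<exists>q\<in>R. q \<noteq> 0"
  proof (rule ccontr)
    assume "\<not> (\<exists>q\<in>R. q \<noteq> 0)"
    then have R: "R \<subseteq> {0}" by blast
    obtain u :: 'e where u: "u \<noteq> 0" using assms(1) by blast
    have "R \<subseteq> {c *\<^sub>R e |c e. 0 \<le> c \<and> e \<in> {u}}"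
      using R by (force intro: exI[of _ 0])
    then have "{c *\<^sub>R e |c e. 0 \<le> c \<and> e \<in> {u}} = R"
      by (rule T_set_maximal[OF assms(2) norm_additive_cone[OF norm_additive_singleton]])
    moreover have "u \<in> {c *\<^sub>R e |c e. 0 \<le> c \<and> e \<in> {u}}"
      by (auto intro: exI[of _ 1])
    ultimately show False using R u by blast
  qed
  then obtain q where q: "q \<in> R" "q \<noteq> 0" by blast
  then have "(r / norm q) *\<^sub>R q \<in> R"
    using assms by (intro T_set_scaleR) auto
  moreover have "norm ((r / norm q) *\<^sub>R q) = r"
    using q assms(3) by simp
  ultimately show ?thesis by blast
qed

section \<open>Peak sets\<close>

definition peak_set ::
    "('x::topological_space \<Rightarrow>\<^sub>C 'e::real_normed_vector) set \<Rightarrow> 'x \<Rightarrow> 'e set \<Rightarrow> ('x \<Rightarrow>\<^sub>C 'e) set"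
  where "peak_set A x R = {f \<in> A. norm (f x) = norm f \<and> f x \<in> R}"

lemma apply_bcontfun_sum_list:
  "apply_bcontfun (sum_list fs) x = sum_list (map (\<lambda>f. apply_bcontfun f x) fs)"
  for fs :: "('x::topological_space \<Rightarrow>\<^sub>C 'e::real_normed_vector) list"
  by (induction fs) auto

lemma subspace_sum_list: "subspace A \<Longrightarrow> set fs \<subseteq> A \<Longrightarrow> sum_list fs \<in> A"
  by (induction fs) (auto simp: subspace_0 subspace_add)

lemma C0_attains_norm:
  assumes "f \<in> C0"
  shows "\<exists>x. norm (apply_bcontfun f x) = norm f"
proof (cases "norm f = 0")
  case True
  then show ?thesis by simp
next
  case False
  then have pos: "norm f / 2 > 0" by simp
  define K where "K = {x. norm f / 2 \<le> norm (f x)}"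
  have "compact K"
    using assms pos unfolding C0_def K_def by blast
  moreover have "K \<noteq> {}"
  proof
    assume "K = {}"
    then have "norm (f x) \<le> norm f / 2" for x
      unfolding K_def using less_eq_real_def linorder_not_le by blast
    then have "norm f \<le> norm f / 2" by (rule norm_bound)
    then show False using pos by linarith
  qed
  ultimately obtain x where x: "x \<in> K" "\<And>y. y \<in> K \<Longrightarrow> norm (f y) \<le> norm (f x)"
    using continuous_attains_sup[of K "\<lambda>x. norm (f x)"] by (auto intro: continuous_on_norm)
  have "norm (f y) \<le> norm (f x)" for y
    using x unfolding K_def by (cases "norm f / 2 \<le> norm (f y)") auto
  then have "norm f \<le> norm (f x)" by (rule norm_bound)
  then show ?thesis using norm_bounded[of f x] by (intro exI[of _ x]) simp
qed

lemma norm_additive_peak_set: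
  assumes "norm_additive R"
  shows "norm_additive (peak_set A x R)"
proof (rule norm_additiveI)
  fix fs assume fs: "set fs \<subseteq> peak_set A x R"
  have "sum_list (map norm fs) = sum_list (map norm (map (\<lambda>f. apply_bcontfun f x) fs))"
    using fs by (induction fs) (auto simp: peak_set_def)
  also have "\<dots> = norm (sum_list fs x)"
    unfolding apply_bcontfun_sum_list
    by (rule norm_additiveD[OF assms, symmetric]) (use fs in \<open>auto simp: peak_set_def\<close>)
  also have "\<dots> \<le> norm (sum_list fs)" by (rule norm_bounded)
  finally show "sum_list (map norm fs) \<le> norm (sum_list fs)" .
qed

text \<open>
  If the sum of finitely many members of \<open>S\<close> attains its norm at \<open>x\<close>, then at \<open>x\<close> no summand can
  fall short of its norm and the triangle inequality cannot lose anything. So the sets on which the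
  members of \<open>S\<close> peak have the finite intersection property, and all but the one of the zero
  function are compact. Passing to the set of finite sums first makes the values at the common peak
  point norm additive as well.
\<close>

lemma norm_additive_subset_peak_set:
  fixes S :: "('x::topological_space \<Rightarrow>\<^sub>C 'e::real_normed_vector) set"
  assumes A: "subspace A" "A \<subseteq> C0" and S: "norm_additive S" "S \<subseteq> A"
  shows "\<exists>x R. T_set R \<and> S \<subseteq> peak_set A x R"
proof -
  define G where "G = {sum_list fs |fs. set fs \<subseteq> S}"
  have G: "norm_additive G"
    unfolding G_def by (rule norm_additive_sums[OF S(1)])
  have "G \<subseteq> A"
    unfolding G_def using subspace_sum_list[OF A(1)] S(2) by blast
  define P where "P g = {x. norm g \<le> norm (apply_bcontfun g x)}" for g :: "'x \<Rightarrow>\<^sub>C 'e"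
  have finite_peak: "(\<Inter>g\<in>I. P g) \<noteq> {}" if "finite I" "I \<subseteq> G" for I
  proof -
    obtain gs where gs: "set gs = I" using finite_list[OF \<open>finite I\<close>] by blast
    have "sum_list gs \<in> C0"
      using subspace_sum_list[OF A(1)] gs that(2) \<open>G \<subseteq> A\<close> A(2) by blast
    then obtain x where x: "norm (sum_list gs x) = norm (sum_list gs)"
      using C0_attains_norm by blast
    have "x \<in> P g" if "g \<in> I" for g
    proof -
      have "sum_list (map norm gs) = norm (sum_list gs x)"
        using x norm_additiveD[OF G, of gs] gs \<open>I \<subseteq> G\<close> by simp
      also have "\<dots> \<le> sum_list (map (\<lambda>g. norm (apply_bcontfun g x)) gs)"
        using norm_sum_list_le[of "map (\<lambda>g. apply_bcontfun g x) gs"]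
        by (simp add: apply_bcontfun_sum_list comp_def)
      finally have "sum_list (map (\<lambda>g. norm g - norm (apply_bcontfun g x)) gs) \<le> 0"
        by (simp add: sum_list_subtractf)
      moreover have "norm g - norm (g x) \<le> sum_list (map (\<lambda>g. norm g - norm (apply_bcontfun g x)) gs)"
        by (intro member_le_sum_list) (use \<open>g \<in> I\<close> gs norm_bounded in auto)
      ultimately show ?thesis by (simp add: P_def)
    qed
    then show ?thesis by blast
  qed
  obtain x where x: "\<And>g. g \<in> G \<Longrightarrow> norm (g x) = norm g"
  proof (cases "G \<subseteq> {0}")
    case True
    then have "norm (apply_bcontfun g undefined) = norm g" if "g \<in> G" for g
      using that by auto
    then show ?thesis using that by blast
  next
    case False
    then obtain g where g: "g \<in> G" "g \<noteq> 0" by blast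
    have "compact (P g)"
      using g \<open>G \<subseteq> A\<close> A(2) unfolding C0_def P_def by auto
    moreover have "closed (P h)" for h
      unfolding P_def by (intro closed_Collect_le continuous_intros) auto
    moreover have "P g \<inter> (\<Inter>h\<in>I. P h) \<noteq> {}" if "finite I" "I \<subseteq> G" for I
      using finite_peak[of "insert g I"] that g by simp
    ultimately have "P g \<inter> (\<Inter>h\<in>G. P h) \<noteq> {}"
      by (rule compact_imp_fip_image)
    then obtain x where "\<And>h. h \<in> G \<Longrightarrow> norm h \<le> norm (h x)"
      by (auto simp: P_def)
    then show ?thesis
      using that[of x] norm_bounded order_antisym by blast
  qed
  have mem_G: "f \<in> G" if "f \<in> S" for f
    unfolding G_def using that by (auto intro!: exI[of _ "[f]"])
  have "norm_additive ((\<lambda>f. apply_bcontfun f x) ` S)"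
    unfolding norm_additive_def
  proof (intro allI impI)
    fix es assume "set es \<subseteq> (\<lambda>f. apply_bcontfun f x) ` S"
    from list_in_image[OF this] obtain fs where es: "es = map (\<lambda>f. apply_bcontfun f x) fs" and fs: "set fs \<subseteq> S"
      by blast
    have "norm (sum_list es) = norm (sum_list fs)"
      unfolding es apply_bcontfun_sum_list[symmetric] using fs by (intro x) (auto simp: G_def)
    also have "\<dots> = sum_list (map norm fs)"
      using fs by (rule norm_additiveD[OF S(1)])
    also have "\<dots> = sum_list (map norm es)"
      unfolding es using fs by (induction fs) (auto simp: x mem_G)
    finally show "norm (sum_list es) = sum_list (map norm es)" .
  qed
  then obtain R where "T_set R" "(\<lambda>f. apply_bcontfun f x) ` S \<subseteq> R"
    using norm_additive_extends_to_T_set by blast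
  then have "S \<subseteq> peak_set A x R"
    using S(2) x mem_G by (auto simp: peak_set_def)
  then show ?thesis using \<open>T_set R\<close> by blast
qed

text \<open>
  A larger norm additive set lies in a peak set of some \<open>(z, R')\<close>. Separation forces \<open>z = y\<close>, and as
  every element of \<open>R\<close> is the value at \<open>y\<close> of a function that peaks there, \<open>R \<subseteq> R'\<close>.
\<close>

lemma peak_set_maximal:
  fixes B :: "('y::topological_space \<Rightarrow>\<^sub>C 'f::real_normed_vector) set"
  assumes B: "separating_subspace B"
    and attains: "\<And>u. \<exists>g\<in>B. apply_bcontfun g y = u \<and> norm g = norm u"
    and nontrivial: "\<exists>u::'f. u \<noteq> 0"
    and R: "T_set R"
    and S: "norm_additive S" "S \<subseteq> B" "peak_set B y R \<subseteq> S"
  shows "S = peak_set B y R"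
proof -
  have "subspace B" "B \<subseteq> C0"
    using B by (simp_all add: separating_subspace_def)
  from norm_additive_subset_peak_set[OF this S(1,2)]
  obtain z R' where R': "T_set R'" and sub: "S \<subseteq> peak_set B z R'"
    by blast
  have "z = y"
  proof (rule ccontr)
    assume "z \<noteq> y"
    obtain u where u: "u \<in> R" "norm u = 1"
      using T_set_element_of_norm[OF nontrivial R, of 1] by auto
    obtain g where g: "g \<in> B" "g y = u" "norm g = norm u" "g z = 0"
      using B \<open>z \<noteq> y\<close> unfolding separating_subspace_def by metis
    then have "g \<in> peak_set B y R"
      using u by (simp add: peak_set_def)
    with S(3) sub have "g \<in> peak_set B z R'" by blast
    with g show False using u by (simp add: peak_set_def)
  qed
  have "R \<subseteq> R'"
  proof
    fix u assume "u \<in> R"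
    obtain g where g: "g \<in> B" "g y = u" "norm g = norm u" using attains by blast
    then have "g \<in> peak_set B y R"
      using \<open>u \<in> R\<close> by (simp add: peak_set_def)
    with S(3) sub have "g \<in> peak_set B z R'" by blast
    with g show "u \<in> R'" using \<open>z = y\<close> by (simp add: peak_set_def)
  qed
  then have "R' = R"
    by (rule T_set_maximal[OF R T_set_norm_additive[OF R']])
  then show ?thesis using sub S(3) \<open>z = y\<close> by blast
qed

section \<open>Surjective isometries between function spaces\<close>

locale surjective_isometry =
  fixes A :: "('x::t2_space \<Rightarrow>\<^sub>C 'e::real_normed_vector) set"
    and B :: "('y::t2_space \<Rightarrow>\<^sub>C 'f::real_normed_vector) set"
    and T :: "('x \<Rightarrow>\<^sub>C 'e) \<Rightarrow> ('y \<Rightarrow>\<^sub>C 'f)"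
  assumes A: "completely_regular_subspace A"
    and B: "separating_subspace B"
    and attains: "\<And>y u. \<exists>g\<in>B. apply_bcontfun g y = u \<and> norm g = norm u"
    and linear: "real_linear_on A T"
    and isometry: "isometry_on A T"
    and onto: "T ` A = B"
    and nontrivial: "\<exists>u::'e. u \<noteq> 0"
begin

lemma subspace_A: "subspace A"
  using A by (simp add: completely_regular_subspace_def)

lemma bump:
  assumes "open U" "x \<in> U"
  shows "\<exists>f\<in>A. apply_bcontfun f x = u \<and> norm f = norm u \<and> (\<forall>z. z \<notin> U \<longrightarrow> apply_bcontfun f z = 0)"
  using A assms by (simp add: completely_regular_subspace_def interior_open)

lemma T_add: "f \<in> A \<Longrightarrow> g \<in> A \<Longrightarrow> T (f + g) = T f + T g"
  and T_scaleR: "f \<in> A \<Longrightarrow> T (c *\<^sub>R f) = c *\<^sub>R T f"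
  using linear by (simp_all add: real_linear_on_def)

lemma T_zero: "T 0 = 0"
  using T_scaleR[OF subspace_0[OF subspace_A], of 0] by simp

lemma T_diff: "f \<in> A \<Longrightarrow> g \<in> A \<Longrightarrow> T (f - g) = T f - T g"
  using T_add[of f "(- 1) *\<^sub>R g"] T_scaleR[of g "- 1"] subspace_scale[OF subspace_A, of g "- 1"]
  by simp

lemma norm_T: "f \<in> A \<Longrightarrow> norm (T f) = norm f"
  using isometry subspace_0[OF subspace_A] unfolding isometry_on_def
  by (metis T_zero dist_0_norm dist_commute)

lemma T_sum_list: "set fs \<subseteq> A \<Longrightarrow> T (sum_list fs) = sum_list (map T fs)"
  by (induction fs) (auto simp: T_zero T_add subspace_sum_list[OF subspace_A])

lemma norm_additive_image_iff:
  assumes "S \<subseteq> A"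
  shows "norm_additive (T ` S) \<longleftrightarrow> norm_additive S"
proof -
  have eq: "norm (sum_list (map T fs)) = norm (sum_list fs)"
      "sum_list (map norm (map T fs)) = sum_list (map norm fs)" if "set fs \<subseteq> S" for fs
  proof -
    show "norm (sum_list (map T fs)) = norm (sum_list fs)"
      using T_sum_list[of fs] norm_T[of "sum_list fs"] subspace_sum_list[OF subspace_A, of fs]
        subset_trans[OF that assms] by simp
    show "sum_list (map norm (map T fs)) = sum_list (map norm fs)"
      using that assms norm_T by (induction fs) auto
  qed
  show ?thesis
  proof
    assume image: "norm_additive (T ` S)"
    show "norm_additive S"
      unfolding norm_additive_def
    proof (intro allI impI)
      fix fs assume fs: "set fs \<subseteq> S"
      have "norm (sum_list (map T fs)) = sum_list (map norm (map T fs))"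
        by (rule norm_additiveD[OF image]) (use fs in auto)
      then show "norm (sum_list fs) = sum_list (map norm fs)"
        using eq[OF fs] by simp
    qed
  next
    assume S: "norm_additive S"
    show "norm_additive (T ` S)"
      unfolding norm_additive_def
    proof (intro allI impI)
      fix gs assume "set gs \<subseteq> T ` S"
      from list_in_image[OF this] obtain fs where gs: "gs = map T fs" and fs: "set fs \<subseteq> S" by blast
      show "norm (sum_list gs) = sum_list (map norm gs)"
        unfolding gs eq[OF fs] using fs by (rule norm_additiveD[OF S])
    qed
  qed
qed

lemma nontrivial_codomain: "\<exists>v::'f. v \<noteq> 0"
proof -
  obtain u :: 'e where u: "u \<noteq> 0" using nontrivial by blast
  obtain f where f: "f \<in> A" "norm f = norm u"
    using bump[of UNIV undefined u] by auto
  then have "T f \<noteq> 0" using norm_T[of f] u by auto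
  then obtain y where "T f y \<noteq> 0" by (metis bcontfun_eqI zero_bcontfun.rep_eq)
  then show ?thesis by blast
qed

text \<open>
  For a T-set \<open>R\<close> the inclusion is an equality, since the image of \<open>peak_set A x Q\<close> is a maximal
  norm additive subset of \<open>B\<close>.
\<close>

definition carried :: "'y \<Rightarrow> 'f set \<Rightarrow> 'x \<Rightarrow> bool"
  where "carried y R x \<longleftrightarrow> (\<exists>Q. T_set Q \<and> T ` peak_set A x Q \<subseteq> peak_set B y R)"

text \<open>
  The preimage of the peak set of \<open>(y, R)\<close> is norm additive, hence contained in a peak set, whose
  image cannot be larger than the maximal set it started from.
\<close>

lemma carried_exists:
  assumes R: "T_set R"
  shows "\<exists>x. carried y R x"
proof -
  define S where "S = {f \<in> A. T f \<in> peak_set B y R}"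
  have "S \<subseteq> A" by (auto simp: S_def)
  have image: "T ` S = peak_set B y R"
  proof
    show "peak_set B y R \<subseteq> T ` S"
      using onto by (auto simp: S_def peak_set_def)
  qed (auto simp: S_def)
  have "norm_additive (T ` S)"
    unfolding image by (rule norm_additive_peak_set[OF T_set_norm_additive[OF R]])
  then have "norm_additive S"
    by (simp only: norm_additive_image_iff[OF \<open>S \<subseteq> A\<close>])
  moreover have "A \<subseteq> C0"
    using A by (simp add: completely_regular_subspace_def)
  ultimately obtain x Q where Q: "T_set Q" and sub: "S \<subseteq> peak_set A x Q"
    using norm_additive_subset_peak_set[OF subspace_A _ _ \<open>S \<subseteq> A\<close>] by blast
  have PA: "peak_set A x Q \<subseteq> A" by (auto simp: peak_set_def)
  have "T ` peak_set A x Q = peak_set B y R"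
  proof (rule peak_set_maximal[OF B attains nontrivial_codomain R])
    show "norm_additive (T ` peak_set A x Q)"
      unfolding norm_additive_image_iff[OF PA]
      by (rule norm_additive_peak_set[OF T_set_norm_additive[OF Q]])
    show "T ` peak_set A x Q \<subseteq> B" using PA onto by blast
    show "peak_set B y R \<subseteq> T ` peak_set A x Q" using sub image by blast
  qed
  then show ?thesis using Q unfolding carried_def by blast
qed

text \<open>
  The sum of two bumps of height 1 with disjoint supports peaks at both points, so its image peaks
  at \<open>y\<close> with a value of norm 1 in \<open>R \<inter> R'\<close>.
\<close>

lemma carried_same_point:
  assumes "carried y R x" "carried y R' x'" and disj: "R \<inter> R' = {0}"
  shows "x = x'"
proof (rule ccontr)
  assume "x \<noteq> x'"
  obtain Q where Q: "T_set Q" "T ` peak_set A x Q \<subseteq> peak_set B y R"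
    using assms(1) by (auto simp: carried_def)
  obtain Q' where Q': "T_set Q'" "T ` peak_set A x' Q' \<subseteq> peak_set B y R'"
    using assms(2) by (auto simp: carried_def)
  obtain U U' where U: "open U" "open U'" "x \<in> U" "x' \<in> U'" "U \<inter> U' = {}"
    using hausdorff[OF \<open>x \<noteq> x'\<close>] by blast
  obtain u where u: "u \<in> Q" "norm u = 1"
    using T_set_element_of_norm[OF nontrivial Q(1), of 1] by auto
  obtain u' where u': "u' \<in> Q'" "norm u' = 1"
    using T_set_element_of_norm[OF nontrivial Q'(1), of 1] by auto
  obtain f where f: "f \<in> A" "f x = u" "norm f = 1" "\<And>z. z \<notin> U \<Longrightarrow> f z = 0"
    using bump[OF U(1,3), of u] u by auto
  obtain f' where f': "f' \<in> A" "f' x' = u'" "norm f' = 1" "\<And>z. z \<notin> U' \<Longrightarrow> f' z = 0"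
    using bump[OF U(2,4), of u'] u' by auto
  define h where "h = f + f'"
  have "h \<in> A" unfolding h_def using f f' by (simp add: subspace_add[OF subspace_A])
  have "norm (h z) \<le> 1" for z
  proof (cases "z \<in> U")
    case True
    then have "f' z = 0" using f'(4) U(5) by blast
    then show ?thesis using norm_bounded[of f z] f(3) by (simp add: h_def)
  next
    case False
    then show ?thesis using f(4) norm_bounded[of f' z] f'(3) by (simp add: h_def)
  qed
  then have "norm h \<le> 1" by (rule norm_bound)
  have hx: "h x = u" "h x' = u'"
    using f f' U by (auto simp: h_def)
  have "norm h = 1"
    using \<open>norm h \<le> 1\<close> norm_bounded[of h x] hx u by simp
  then have "h \<in> peak_set A x Q" "h \<in> peak_set A x' Q'"
    using hx u u' \<open>h \<in> A\<close> by (auto simp: peak_set_def)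
  then have "T h \<in> peak_set B y R" "T h \<in> peak_set B y R'"
    using Q(2) Q'(2) by blast+
  then have "T h y \<in> R \<inter> R'" "norm (T h y) = 1"
    using norm_T[OF \<open>h \<in> A\<close>] \<open>norm h = 1\<close> by (auto simp: peak_set_def)
  then show False using disj by simp
qed

lemma common_carrier_point:
  assumes "property_Dw TYPE('f)"
  shows "\<exists>x. \<forall>R. T_set R \<longrightarrow> carried y R x"
proof -
  from assms obtain R\<^sub>0 :: "'f set" where R\<^sub>0: "T_set R\<^sub>0"
    and link: "\<forall>R. T_set R \<and> R \<noteq> R\<^sub>0 \<longrightarrow>
      R\<^sub>0 \<inter> R = {0} \<or> (\<exists>L. T_set L \<and> R\<^sub>0 \<inter> L = {0} \<and> R \<inter> L = {0})"
    unfolding property_Dw_def by (elim exE conjE)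
  obtain x where x: "carried y R\<^sub>0 x" using carried_exists[OF R\<^sub>0] by blast
  have "carried y R x" if R: "T_set R" for R
  proof (cases "R = R\<^sub>0")
    case True
    then show ?thesis using x by simp
  next
    case False
    obtain x' where x': "carried y R x'" using carried_exists[OF R] by blast
    from link R False have "R\<^sub>0 \<inter> R = {0} \<or> (\<exists>L. T_set L \<and> R\<^sub>0 \<inter> L = {0} \<and> R \<inter> L = {0})"
      by simp
    then have "x = x'"
    proof
      assume "R\<^sub>0 \<inter> R = {0}"
      then show ?thesis by (rule carried_same_point[OF x x'])
    next
      assume "\<exists>L. T_set L \<and> R\<^sub>0 \<inter> L = {0} \<and> R \<inter> L = {0}"
      then obtain L where L: "T_set L" "R\<^sub>0 \<inter> L = {0}" "R \<inter> L = {0}"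
        by (elim exE conjE)
      obtain z where z: "carried y L z" using carried_exists[OF L(1)] by blast
      show ?thesis
        using carried_same_point[OF x z L(2)] carried_same_point[OF x' z L(3)] by simp
    qed
    then show ?thesis using x' by simp
  qed
  then show ?thesis by blast
qed

lemma image_vanishes:
  assumes x: "\<And>R. T_set R \<Longrightarrow> carried y R x" and f: "f \<in> A" "f x = 0"
  shows "T f y = 0"
proof -
  obtain R where R: "T_set R" "T f y \<in> R"
    using norm_additive_extends_to_T_set[OF norm_additive_singleton[of "T f y"]] by blast
  obtain Q where Q: "T_set Q" "T ` peak_set A x Q \<subseteq> peak_set B y R"
    using x[OF R(1)] by (auto simp: carried_def)
  \<comment> \<open>At this height, \<open>f + g\<close> cannot outgrow the bump \<open>g\<close> where \<open>g\<close> vanishes.\<close>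
  obtain q where q: "q \<in> Q" "norm q = norm f"
    using T_set_element_of_norm[OF nontrivial Q(1), of "norm f"] by auto
  have "norm (T f y) \<le> 0 + \<epsilon>" if "\<epsilon> > 0" for \<epsilon>
  proof -
    define U where "U = {z. norm (f z) < \<epsilon>}"
    have "open U"
      unfolding U_def by (intro open_Collect_less continuous_intros) auto
    moreover have "x \<in> U"
      using f that by (simp add: U_def)
    ultimately obtain g where g: "g \<in> A" "g x = q" "norm g = norm q" "\<And>z. z \<notin> U \<Longrightarrow> g z = 0"
      using bump[of U x q] by blast
    have "norm ((f + g) z) \<le> norm f + \<epsilon>" for z
    proof (cases "z \<in> U")
      case True
      have "norm ((f + g) z) \<le> norm (f z) + norm (g z)" by (simp add: norm_triangle_ineq)
      also have "\<dots> \<le> \<epsilon> + norm f"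
        using True norm_bounded[of g z] g q by (simp add: U_def)
      finally show ?thesis by simp
    next
      case False
      then show ?thesis using g(4)[of z] norm_bounded[of f z] that by simp
    qed
    then have "norm (f + g) \<le> norm f + \<epsilon>" by (rule norm_bound)
    have "g \<in> peak_set A x Q"
      using g q by (simp add: peak_set_def)
    then have "T g \<in> peak_set B y R" using Q(2) by blast
    then have "T g y \<in> R" "norm (T g y) = norm f"
      using norm_T[OF g(1)] g q by (auto simp: peak_set_def)
    then have "norm (T f y) + norm f = norm (T (f + g) y)"
      using norm_additive_pair[OF T_set_norm_additive[OF R(1)] R(2)] f g by (simp add: T_add)
    also have "\<dots> \<le> norm (f + g)"
      using norm_bounded[of "T (f + g)" y] norm_T[of "f + g"] f g
      by (simp add: subspace_add[OF subspace_A])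
    finally show ?thesis using \<open>norm (f + g) \<le> norm f + \<epsilon>\<close> by simp
  qed
  then have "norm (T f y) \<le> 0" by (rule field_le_epsilon)
  then show ?thesis by simp
qed

lemma evaluation_operator:
  assumes x: "\<And>R. T_set R \<Longrightarrow> carried y R x"
  shows "\<exists>V :: 'e \<Rightarrow>\<^sub>L 'f. norm V \<le> 1 \<and> (\<forall>f\<in>A. T f y = blinfun_apply V (f x))"
proof -
  have "\<forall>u. \<exists>f\<in>A. apply_bcontfun f x = u \<and> norm f = norm u"
    using bump[of UNIV x] by auto
  then obtain h where h: "\<And>u. h u \<in> A" "\<And>u. h u x = u" "\<And>u. norm (h u) = norm u"
    by metis
  have rep: "T f y = T (h (f x)) y" if "f \<in> A" for f
  proof -
    have "T (f - h (f x)) y = 0"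
      by (rule image_vanishes[OF x]) (use that h in \<open>auto simp: subspace_diff[OF subspace_A]\<close>)
    then show ?thesis using that h by (simp add: T_diff)
  qed
  define v where "v u = T (h u) y" for u
  have bound: "norm (v u) \<le> norm u" for u
    using norm_bounded[of "T (h u)" y] norm_T[OF h(1)] h(3) by (simp add: v_def)
  have "bounded_linear v"
  proof (rule bounded_linear_intro[where K = 1])
    show "v (u + w) = v u + v w" for u w
      using rep[of "h u + h w"] h by (simp add: v_def T_add subspace_add[OF subspace_A])
    show "v (c *\<^sub>R u) = c *\<^sub>R v u" for c u
      using rep[of "c *\<^sub>R h u"] h by (simp add: v_def T_scaleR subspace_scale[OF subspace_A])
    show "norm (v u) \<le> norm u * 1" for u
      using bound by simp
  qed
  then have V: "blinfun_apply (Blinfun v) = v" by (rule bounded_linear_Blinfun_apply)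
  have "norm (Blinfun v) \<le> 1"
    by (rule norm_blinfun_bound) (use bound V in auto)
  moreover have "T f y = Blinfun v (f x)" if "f \<in> A" for f
    using rep[OF that] by (simp add: V v_def)
  ultimately show ?thesis by blast
qed

text \<open>
  For continuity, a bump at \<open>\<phi>(y)\<close> supported in \<open>U\<close> whose image does not vanish at \<open>y\<close> confines
  \<open>\<phi>\<close> to \<open>U\<close> wherever that image is nonzero.
\<close>

theorem weighted_composition:
  assumes Dw: "property_Dw TYPE('f)"
  shows "\<exists>(\<phi> :: 'y \<Rightarrow> 'x) (V :: 'y \<Rightarrow> 'e \<Rightarrow>\<^sub>L 'f). continuous_on UNIV \<phi> \<and>
    (\<forall>y. norm (V y) \<le> 1) \<and> (\<forall>y. \<forall>f\<in>A. T f y = blinfun_apply (V y) (f (\<phi> y)))"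
proof -
  obtain \<phi> where \<phi>: "\<And>y R. T_set R \<Longrightarrow> carried y R (\<phi> y)"
    using common_carrier_point[OF Dw] by metis
  then have "\<forall>y. \<exists>V :: 'e \<Rightarrow>\<^sub>L 'f. norm V \<le> 1 \<and> (\<forall>f\<in>A. T f y = blinfun_apply V (f (\<phi> y)))"
    using evaluation_operator by blast
  then obtain V :: "'y \<Rightarrow> 'e \<Rightarrow>\<^sub>L 'f" where V: "\<And>y. norm (V y) \<le> 1"
      "\<And>y f. f \<in> A \<Longrightarrow> T f y = blinfun_apply (V y) (f (\<phi> y))"
    by metis
  obtain R :: "'f set" where R: "T_set R"
    using norm_additive_extends_to_T_set[OF norm_additive_singleton] by blast
  have "\<exists>W. open W \<and> y \<in> W \<and> (\<forall>z\<in>W. \<phi> z \<in> U)" if U: "open U" "\<phi> y \<in> U" for y U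
  proof -
    obtain Q where Q: "T_set Q" "T ` peak_set A (\<phi> y) Q \<subseteq> peak_set B y R"
      using \<phi>[OF R, of y] by (auto simp: carried_def)
    obtain q where q: "q \<in> Q" "norm q = 1"
      using T_set_element_of_norm[OF nontrivial Q(1), of 1] by auto
    obtain f where f: "f \<in> A" "f (\<phi> y) = q" "norm f = norm q" "\<And>z. z \<notin> U \<Longrightarrow> f z = 0"
      using bump[OF U, of q] by blast
    have "f \<in> peak_set A (\<phi> y) Q"
      using f q by (simp add: peak_set_def)
    then have "T f \<in> peak_set B y R" using Q(2) by blast
    then have "norm (T f y) = 1"
      using norm_T[OF f(1)] f(3) q(2) by (simp add: peak_set_def)
    moreover have "open {z. T f z \<noteq> 0}"
      by (intro open_Collect_neq continuous_intros) auto
    moreover have "\<phi> z \<in> U" if "T f z \<noteq> 0" for z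
      using that V(2)[OF f(1), of z] f(4)[of "\<phi> z"] by fastforce
    ultimately show ?thesis
      by (intro exI[of _ "{z. T f z \<noteq> 0}"]) auto
  qed
  then have "continuous_on UNIV \<phi>"
    unfolding continuous_on_topological by (metis UNIV_I)
  then show ?thesis using V by blast
qed

end

lemma completely_regular_imp_separating:
  fixes A :: "('x::t2_space \<Rightarrow>\<^sub>C 'e::real_normed_vector) set"
  assumes "completely_regular_subspace A"
  shows "separating_subspace A"
proof -
  have "\<exists>f\<in>A. apply_bcontfun f x1 = u \<and> norm f = norm u \<and> apply_bcontfun f x2 = 0"
    if "x1 \<noteq> x2" for x1 x2 u
  proof -
    have "x1 \<in> interior (- {x2})"
      using that by (simp add: interior_open open_Compl)
    then have "\<exists>f\<in>A. apply_bcontfun f x1 = u \<and> norm f = norm u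
        \<and> (\<forall>z. z \<notin> - {x2} \<longrightarrow> apply_bcontfun f z = 0)"
      using assms unfolding completely_regular_subspace_def by blast
    then show ?thesis by auto
  qed
  then show ?thesis
    using assms unfolding completely_regular_subspace_def separating_subspace_def by blast
qed

text \<open>
  With a second point at hand, separation provides the values; a one-point space carries the
  constant functions.
\<close>

lemma separating_attains_values:
  fixes B :: "('y::t2_space \<Rightarrow>\<^sub>C 'f::real_normed_vector) set"
  assumes B: "separating_subspace B" and one_point: "(\<forall>y1 y2 :: 'y. y1 = y2) \<Longrightarrow> B = C0"
  shows "\<exists>g\<in>B. apply_bcontfun g y = u \<and> norm g = norm u"
proof (cases "\<exists>z. z \<noteq> y")
  case True
  then show ?thesis using B unfolding separating_subspace_def by metis
next
  case False
  then have single: "z = y" for z by blast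
  then have "\<forall>y1 y2 :: 'y. y1 = y2" by metis
  then have "B = C0" by (rule one_point)
  moreover have "const_bcontfun u \<in> (C0 :: ('y \<Rightarrow>\<^sub>C 'f) set)"
  proof -
    have "finite S" for S :: "'y set"
      using finite_subset[of S "{y}"] single by blast
    then show ?thesis unfolding C0_def by (auto intro: finite_imp_compact)
  qed
  moreover have "norm (const_bcontfun u :: 'y \<Rightarrow>\<^sub>C 'f) = norm u"
    using norm_bounded[of "const_bcontfun u :: 'y \<Rightarrow>\<^sub>C 'f" y]
    by (intro order_antisym norm_bound) auto
  ultimately show ?thesis by (intro bexI[of _ "const_bcontfun u"]) auto
qed

lemma contraction_norm_le:
  fixes L :: "'a::real_normed_vector \<Rightarrow>\<^sub>L 'b::real_normed_vector"
  assumes "norm L \<le> 1"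
  shows "norm (L e) \<le> norm e"
  using norm_blinfun[of L e] mult_right_mono[OF assms norm_ge_zero[of e]] by simp

section \<open>The representation theorem\<close>

text \<open>
  For \<open>E = {0}\<close> everything vanishes and the second part is void. Otherwise \<open>T\<close> and, in the second
  part, its inverse are weighted compositions. Composing the two representations shows that the
  underlying maps are mutually inverse, because a function value at \<open>x\<close> cannot be determined by the
  value at another point, and that the operators are mutually inverse contractions.
\<close>

theorem theorem3p9:
  fixes A :: "('x::t2_space \<Rightarrow>\<^sub>C 'e::real_normed_vector) set"
    and B :: "('y::t2_space \<Rightarrow>\<^sub>C 'f::real_normed_vector) set"
    and T :: "('x \<Rightarrow>\<^sub>C 'e) \<Rightarrow> ('y \<Rightarrow>\<^sub>C 'f)"
  assumes "locally_compact_space (euclidean :: 'x topology)"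
    and "locally_compact_space (euclidean :: 'y topology)"
    and "completely_regular_subspace A"
    and "separating_subspace B"
    and one_point: "(\<forall>y1 y2 :: 'y. y1 = y2) \<Longrightarrow> B = C0"
    and "real_linear_on A T"
    and "isometry_on A T"
    and "T ` A = B"
    and "property_Dw TYPE('f)"
  shows "\<exists>(\<phi> :: 'y \<Rightarrow> 'x) (V :: 'y \<Rightarrow> 'e \<Rightarrow>\<^sub>L 'f).
    continuous_on UNIV \<phi> \<and>
    (\<forall>y. norm (V y) \<le> 1) \<and>
    (\<forall>y. \<forall>f\<in>A. apply_bcontfun (T f) y = blinfun_apply (V y) (apply_bcontfun f (\<phi> y))) \<and>
    ((\<exists>u::'e. u \<noteq> 0) \<and> property_Dw TYPE('e) \<and> completely_regular_subspace B \<longrightarrow>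
      (\<exists>\<psi>. homeomorphism UNIV UNIV \<phi> \<psi>) \<and>
      (\<forall>y. surj (blinfun_apply (V y)) \<and> isometry_on UNIV (blinfun_apply (V y))))"
proof (cases "\<exists>u::'e. u \<noteq> 0")
  case False
  then have zero: "u = 0" for u :: 'e by blast
  have "T f y = 0" if "f \<in> A" for f y
  proof -
    have "f = 0 *\<^sub>R f" by (rule bcontfun_eqI) (metis zero)
    then have "T f = 0 *\<^sub>R T f"
      using \<open>real_linear_on A T\<close> that unfolding real_linear_on_def by metis
    then show ?thesis by simp
  qed
  then show ?thesis
    using False by (intro exI[of _ "\<lambda>_. undefined"] exI[of _ "\<lambda>_. 0"]) auto
next
  case True
  interpret T: surjective_isometry A B T
    by unfold_locales (use assms True separating_attains_values[OF assms(4) one_point] in auto)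
  obtain \<phi> :: "'y \<Rightarrow> 'x" and V :: "'y \<Rightarrow> 'e \<Rightarrow>\<^sub>L 'f" where
      \<phi>: "continuous_on UNIV \<phi>" and V: "\<And>y. norm (V y) \<le> 1"
      and rep: "\<And>y f. f \<in> A \<Longrightarrow> T f y = blinfun_apply (V y) (f (\<phi> y))"
    using T.weighted_composition[OF assms(9)] by blast
  have "(\<exists>\<psi>. homeomorphism UNIV UNIV \<phi> \<psi>) \<and>
      (\<forall>y. surj (blinfun_apply (V y)) \<and> isometry_on UNIV (blinfun_apply (V y)))"
    if Dw: "property_Dw TYPE('e)" and B: "completely_regular_subspace B"
  proof -
    define T' where "T' = inv_into A T"
    have "inj_on T A"
      using \<open>isometry_on A T\<close> unfolding isometry_on_def inj_on_def by (metis dist_eq_0_iff)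
    have T'T: "T' (T f) = f" if "f \<in> A" for f
      unfolding T'_def using \<open>inj_on T A\<close> that by (rule inv_into_f_f)
    have TT': "T (T' g) = g" and T'A: "T' g \<in> A" if "g \<in> B" for g
      unfolding T'_def using that \<open>T ` A = B\<close> by (auto intro: f_inv_into_f inv_into_into)
    interpret T': surjective_isometry B A T'
    proof
      show "completely_regular_subspace B" by (rule B)
      show "separating_subspace A" by (rule completely_regular_imp_separating[OF assms(3)])
      show "\<exists>f\<in>A. apply_bcontfun f x = u \<and> norm f = norm u" for x u
        using T.bump[of UNIV x u] by auto
      show "real_linear_on B T'"
        unfolding real_linear_on_def
        by (metis T'A T'T TT' T.T_add T.T_scaleR T.subspace_A subspace_add subspace_scale)
      show "isometry_on B T'"
        using \<open>isometry_on A T\<close> T'A TT' unfolding isometry_on_def by metis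
      show "T' ` B = A"
        using T'A T'T \<open>T ` A = B\<close> by force
      show "\<exists>v::'f. v \<noteq> 0" by (rule T.nontrivial_codomain)
    qed
    obtain \<psi> :: "'x \<Rightarrow> 'y" and W :: "'x \<Rightarrow> 'f \<Rightarrow>\<^sub>L 'e" where
        \<psi>: "continuous_on UNIV \<psi>" and W: "\<And>x. norm (W x) \<le> 1"
        and rep': "\<And>x g. g \<in> B \<Longrightarrow> T' g x = blinfun_apply (W x) (g (\<psi> x))"
      using T'.weighted_composition[OF Dw] by blast
    have WV: "f x = W x (V (\<psi> x) (f (\<phi> (\<psi> x))))" if "f \<in> A" for f x
      using rep'[of "T f" x] rep[OF that] T'T[OF that] that \<open>T ` A = B\<close> by auto
    have VW: "g y = V y (W (\<phi> y) (g (\<psi> (\<phi> y))))" if "g \<in> B" for g y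
      using rep[OF T'A[OF that], of y] rep'[OF that] TT'[OF that] by simp
    have \<phi>\<psi>: "\<phi> (\<psi> x) = x" for x
    proof (rule ccontr)
      assume "\<phi> (\<psi> x) \<noteq> x"
      obtain u :: 'e where u: "u \<noteq> 0" using True by blast
      obtain f where "f \<in> A" "f x = u" "f (\<phi> (\<psi> x)) = 0"
        using T'.B \<open>\<phi> (\<psi> x) \<noteq> x\<close> unfolding separating_subspace_def by metis
      then show False using WV[of f x] u by (simp add: blinfun.zero_right)
    qed
    have \<psi>\<phi>: "\<psi> (\<phi> y) = y" for y
    proof (rule ccontr)
      assume "\<psi> (\<phi> y) \<noteq> y"
      obtain v :: 'f where v: "v \<noteq> 0" using T.nontrivial_codomain by blast
      obtain g where "g \<in> B" "g y = v" "g (\<psi> (\<phi> y)) = 0"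
        using T.B \<open>\<psi> (\<phi> y) \<noteq> y\<close> unfolding separating_subspace_def by metis
      then show False using VW[of g y] v by (simp add: blinfun.zero_right)
    qed
    have "homeomorphism UNIV UNIV \<phi> \<psi>"
      using \<phi> \<psi> \<phi>\<psi> \<psi>\<phi> by (auto intro!: homeomorphismI)
    moreover have "surj (blinfun_apply (V y))" for y
    proof (rule surjI)
      fix v
      obtain g where g: "g \<in> B" "g y = v" using T.attains by blast
      show "V y (W (\<phi> y) v) = v"
        using VW[OF g(1), of y, symmetric] by (simp add: \<psi>\<phi> g(2))
    qed
    moreover have "isometry_on UNIV (blinfun_apply (V y))" for y
    proof -
      have "norm (V y u) = norm u" for u
      proof (rule order_antisym)
        show "norm (V y u) \<le> norm u" by (rule contraction_norm_le[OF V])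
        obtain f where f: "f \<in> A" "f (\<phi> y) = u" using T'.attains by blast
        have "W (\<phi> y) (V y u) = u"
          using WV[OF f(1), of "\<phi> y", symmetric] by (simp add: \<psi>\<phi> f(2))
        then show "norm u \<le> norm (V y u)" using contraction_norm_le[OF W] by metis
      qed
      then show ?thesis
        unfolding isometry_on_def by (metis blinfun.diff_right dist_norm)
    qed
    ultimately show ?thesis by blast
  qed
  then show ?thesis using \<phi> V rep by blast
qed

end
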